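(* Let $\alpha_j=1+\ln\theta_j$ for $j\in[K]$. There exists no $\beta$-PF online algorithm for the multi-class online resource allocation problem with $\beta<\frac1K\sum_{j\in[K]}\alpha_j$.
   Context: Setting (multi-class online resource allocation). Fix a resource budget $B>0$, a number of classes $K\ge1$ and numbers $1\le\theta_1\le\dots\le\theta_K$; $[K]=\{1,\dots,K\}$. An instance is a finite sequence $I=\{(v_t,j_t,r_t)\}_{t=1}^T$ of agents, where $j_t\in[K]$ is the class, $v_t\in[1,\theta_{j_t}]$ the valuation and $r_t\ge0$ the rate limit of agent $t$. The feasible allocations are $\mathcal X=\{\mathbf x: x_t\in[0,r_t]\ \forall t,\ \sum_t x_t\le B\}$, and the utility of class $j$ is $U_j(\mathbf x)=\sum_{t:j_t=j}v_tx_t$. An online algorithm knows $B,K,(\theta_j)$ but not $T$; when agent $t$ arrives it irrevocably chooses $x_t\in[0,r_t]$ depending only on the first $t$ agents, with $\sum_tx_t\le B$. $\beta$-PF. For $\beta\ge1$, an allocation $\mathbf x\in\mathcal X$ is $\beta$-proportionally fair if $\frac1K\sum_{j\in[K]}\frac{U_j(\mathbf w)}{U_j(\mathbf x)}\le\beta$ for every $\mathbf w\in\mathcal X$, where $0/0:=0$ and $a/0:=+\infty$ for $a>0$. An online algorithm is $\beta$-PF if it produces a $\beta$-PF allocation on every instance. *)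

theory Defs
  imports Complex_Main "HOL-Library.Extended_Real"
begin

datatype agent = Agent (valuation: real) (agent_class: nat) (rate_limit: real)

text \<open>Classes are numbered from 1 to K, whereas agents are list positions and hence numbered
  from 0. Only the values of \<open>\<theta>\<close> on \<open>{1..K}\<close> are relevant.\<close>

definition valid_agent :: "nat \<Rightarrow> (nat \<Rightarrow> real) \<Rightarrow> agent \<Rightarrow> bool" where
  "valid_agent K \<theta> a \<longleftrightarrow>
     agent_class a \<in> {1..K} \<and>
     valuation a \<in> {1..\<theta> (agent_class a)} \<and>
     0 \<le> rate_limit a"

definition valid_instance :: "nat \<Rightarrow> (nat \<Rightarrow> real) \<Rightarrow> agent list \<Rightarrow> bool" where
  "valid_instance K \<theta> I \<longleftrightarrow> (\<forall>a\<in>set I. valid_agent K \<theta> a)"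

definition feasible :: "real \<Rightarrow> agent list \<Rightarrow> real list set" where
  "feasible B I =
     {x. length x = length I \<and>
         (\<forall>t<length I. x ! t \<in> {0..rate_limit (I ! t)}) \<and>
         (\<Sum>t<length I. x ! t) \<le> B}"

definition utility :: "agent list \<Rightarrow> nat \<Rightarrow> real list \<Rightarrow> real" where
  "utility I j x = (\<Sum>t | t < length I \<and> agent_class (I ! t) = j. valuation (I ! t) * x ! t)"

definition utility_ratio :: "real \<Rightarrow> real \<Rightarrow> ereal" where
  "utility_ratio a b =
     (if b = 0 then (if a = 0 then 0 else \<infinity>) else ereal (a / b))"

definition proportionally_fair ::
    "real \<Rightarrow> nat \<Rightarrow> real \<Rightarrow> agent list \<Rightarrow> real list \<Rightarrow> bool" where
  "proportionally_fair B K \<beta> I x \<longleftrightarrow>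
     x \<in> feasible B I \<and>
     (\<forall>w\<in>feasible B I.
        ereal (1 / real K) * (\<Sum>j\<in>{1..K}. utility_ratio (utility I j w) (utility I j x)) \<le> ereal \<beta>)"

text \<open>A (deterministic) online algorithm maps the nonempty list of agents seen so far to the
  amount given to the last of them; its value on the empty list is never used.\<close>

definition run :: "(agent list \<Rightarrow> real) \<Rightarrow> agent list \<Rightarrow> real list" where
  "run A I = map (\<lambda>t. A (take (Suc t) I)) [0..<length I]"

definition online_algorithm ::
    "real \<Rightarrow> nat \<Rightarrow> (nat \<Rightarrow> real) \<Rightarrow> (agent list \<Rightarrow> real) \<Rightarrow> bool" where
  "online_algorithm B K \<theta> A \<longleftrightarrow> (\<forall>I. valid_instance K \<theta> I \<longrightarrow> run A I \<in> feasible B I)"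

definition pf_online_algorithm ::
    "real \<Rightarrow> nat \<Rightarrow> (nat \<Rightarrow> real) \<Rightarrow> real \<Rightarrow> (agent list \<Rightarrow> real) \<Rightarrow> bool" where
  "pf_online_algorithm B K \<theta> \<beta> A \<longleftrightarrow>
     online_algorithm B K \<theta> A \<and>
     (\<forall>I. valid_instance K \<theta> I \<longrightarrow> proportionally_fair B K \<beta> I (run A I))"

end

theory Submission
  imports Defs "HOL-Real_Asymp.Real_Asymp"
begin

text \<open>The adversary presents the classes one after the other, with rate limits \<open>B\<close> and, within class
  \<open>j\<close>, valuations rising geometrically from \<open>1\<close> to \<open>\<theta> j\<close> in \<open>n\<close> steps. Comparing with the
  allocation that gives the whole budget to the agent that arrived last, fairness forces the utility
  of class \<open>j\<close> to be at least \<open>B / (K \<beta>)\<close> times the latest valuation at all times. Summation by parts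
  turns these bounds into a lower bound on the budget spent on class \<open>j\<close>, which tends to
  \<open>B / (K \<beta>) * (1 + ln (\<theta> j))\<close> as \<open>n\<close> grows. The total spent is at most \<open>B\<close>.\<close>

lemma length_run [simp]: "length (run A I) = length I"
  by (simp add: run_def)

lemma nth_run: "t < length I \<Longrightarrow> run A I ! t = A (take (Suc t) I)"
  by (simp add: run_def)

text \<open>Each decision depends only on the agents seen so far, so stopping the instance early
  does not change it. A single run can therefore be tested for fairness at every prefix.\<close>

lemma run_take: "run A (take k I) = take k (run A I)"
  by (rule nth_equalityI) (auto simp: nth_run min.absorb1)

lemma valid_instance_take: "valid_instance K \<theta> I \<Longrightarrow> valid_instance K \<theta> (take k I)"
  by (meson in_set_takeD valid_instance_def)

text \<open>The comparison allocation \<open>w\<close> gives the whole budget to agent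
  \<open>t\<close>, which its rate limit permits. Only the class of that agent gains utility from
  \<open>w\<close>, so the fairness sum collapses to a single ratio.\<close>

lemma proportionally_fair_utility_ge:
  assumes pf: "proportionally_fair B K \<beta> I x" and valid: "valid_instance K \<theta> I"
    and t: "t < length I" and rate: "B \<le> rate_limit (I ! t)" and B: "B > 0" and K: "K \<ge> 1"
  shows "valuation (I ! t) * B \<le> real K * \<beta> * utility I (agent_class (I ! t)) x"
proof -
  define w where "w = (replicate (length I) 0)[t := B]"
  define j where "j = agent_class (I ! t)"
  have va: "valid_agent K \<theta> (I ! s)" if "s < length I" for s
    using valid that by (simp add: valid_instance_def)
  have w_nth: "w ! s = (if s = t then B else 0)" if "s < length I" for s
    using that by (simp add: w_def nth_list_update)
  have "(\<Sum>s<length I. w ! s) = (\<Sum>s<length I. if s = t then B else 0)"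
    by (rule sum.cong) (auto simp: w_nth)
  also have "\<dots> = B" using t by simp
  finally have w: "w \<in> feasible B I"
    using va B rate by (auto simp: feasible_def w_nth valid_agent_def) (simp add: w_def)
  have j: "j \<in> {1..K}" using va[OF t] by (simp add: valid_agent_def j_def)
  have v: "valuation (I ! t) \<ge> 1" using va[OF t] by (simp add: valid_agent_def)
  have U: "utility I i w = (if i = j then valuation (I ! t) * B else 0)" for i
  proof -
    have "utility I i w = (\<Sum>s | s < length I \<and> agent_class (I ! s) = i.
            if s = t then valuation (I ! t) * B else 0)"
      unfolding utility_def by (rule sum.cong) (auto simp: w_nth)
    also have "\<dots> = (if i = j then valuation (I ! t) * B else 0)"
      using t by (auto simp: j_def)
    finally show ?thesis .
  qed
  have Ux: "utility I j x \<ge> 0"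
    using pf va unfolding utility_def
    by (intro sum_nonneg) (fastforce simp: proportionally_fair_def feasible_def valid_agent_def)
  have "ereal (1 / real K) * (\<Sum>i\<in>{1..K}. utility_ratio (utility I i w) (utility I i x)) \<le> ereal \<beta>"
    using pf w by (simp add: proportionally_fair_def)
  also have "(\<Sum>i\<in>{1..K}. utility_ratio (utility I i w) (utility I i x)) =
      (\<Sum>i\<in>{1..K}. if i = j then utility_ratio (valuation (I ! t) * B) (utility I j x) else 0)"
    \<comment> \<open>For every other class the numerator is 0, and its ratio is 0 even over a zero
      denominator, by the convention 0/0 = 0.\<close>
    by (rule sum.cong) (auto simp: U utility_ratio_def)
  also have "\<dots> = utility_ratio (valuation (I ! t) * B) (utility I j x)"
    using j by simp
  finally have le: "ereal (1 / real K) * utility_ratio (valuation (I ! t) * B) (utility I j x) \<le> ereal \<beta>" .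
  \<comment> \<open>The numerator is positive, so a zero denominator would make the ratio infinite,
    above the finite \<beta>.\<close>
  have "utility I j x \<noteq> 0"
    using le v B K by (auto simp: utility_ratio_def)
  with le Ux K show ?thesis
    unfolding j_def[symmetric] by (simp add: utility_ratio_def field_simps)
qed

text \<open>Abel summation for \<open>x l = (v l * x l) * (1 / v l)\<close>, with the partial sums
  of \<open>v l * x l\<close>.\<close>

lemma sum_by_parts:
  fixes v x :: "nat \<Rightarrow> real"
  assumes "\<And>i. v i > 0"
  shows "(\<Sum>l\<le>n. x l) = (\<Sum>l\<le>n. v l * x l) / v n
           + (\<Sum>i<n. (\<Sum>l\<le>i. v l * x l) * (1 / v i - 1 / v (Suc i)))"
proof (induction n)
  case 0
  show ?case using assms[of 0] by simp
next
  case (Suc n)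
  then show ?case using assms[of n] assms[of "Suc n"] by (simp add: algebra_simps add_divide_distrib)
qed

text \<open>Since \<open>v\<close> increases, the reciprocals decrease and all coefficients in the
  summation by parts are nonnegative. The lower bounds on the partial sums can thus be inserted term
  by term.\<close>

lemma sum_ge_of_weighted_sums_ge:
  fixes v x :: "nat \<Rightarrow> real"
  assumes pos: "\<And>i. v i > 0" and "mono v"
    and ge: "\<And>i. i \<le> n \<Longrightarrow> c * v i \<le> (\<Sum>l\<le>i. v l * x l)"
  shows "c * (1 + (\<Sum>i<n. 1 - v i / v (Suc i))) \<le> (\<Sum>l\<le>n. x l)"
proof -
  have "c * (1 - v i / v (Suc i)) \<le> (\<Sum>l\<le>i. v l * x l) * (1 / v i - 1 / v (Suc i))"
    if "i < n" for i
  proof -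
    have "1 / v (Suc i) \<le> 1 / v i"
      using pos \<open>mono v\<close> by (intro divide_left_mono) (auto simp: mono_def)
    then have "c * v i * (1 / v i - 1 / v (Suc i))
        \<le> (\<Sum>l\<le>i. v l * x l) * (1 / v i - 1 / v (Suc i))"
      using ge[of i] that by (intro mult_right_mono) auto
    also have "c * v i * (1 / v i - 1 / v (Suc i)) = c * (1 - v i / v (Suc i))"
      using pos[of i] pos[of "Suc i"] by (simp add: field_simps)
    finally show ?thesis .
  qed
  then have "(\<Sum>i<n. c * (1 - v i / v (Suc i)))
      \<le> (\<Sum>i<n. (\<Sum>l\<le>i. v l * x l) * (1 / v i - 1 / v (Suc i)))"
    by (intro sum_mono) auto
  moreover have "c \<le> (\<Sum>l\<le>n. v l * x l) / v n"
    using ge[of n] pos[of n] by (simp add: field_simps)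
  ultimately show ?thesis
    by (subst sum_by_parts[of v x n, OF pos]) (simp add: distrib_left sum_distrib_left)
qed

text \<open>First-order expansion of \<open>exp (- ln a / n)\<close>: this is where the logarithm in
  \<alpha> originates.\<close>

lemma powr_step_tendsto_ln:
  fixes a :: real
  assumes "a > 0"
  shows "(\<lambda>n. real n * (1 - a powr (- 1 / real n))) \<longlonglongrightarrow> ln a"
  using assms by real_asymp

text \<open>Position \<open>t\<close> lies in block \<open>t div Suc n\<close>, which holds the
  class one higher, at step \<open>t mod Suc n\<close>. A block has \<open>n + 1\<close> agents
  because the exponents run from 0 to 1 in steps of \<open>1 / n\<close>, both ends
  included.\<close>

definition rising_instance :: "real \<Rightarrow> nat \<Rightarrow> (nat \<Rightarrow> real) \<Rightarrow> nat \<Rightarrow> agent list" where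
  "rising_instance B K \<theta> n =
     map (\<lambda>t. Agent (\<theta> (Suc (t div Suc n)) powr (real (t mod Suc n) / real n))
                    (Suc (t div Suc n)) B) [0..<K * Suc n]"

lemma length_rising_instance [simp]: "length (rising_instance B K \<theta> n) = K * Suc n"
  by (simp add: rising_instance_def)

lemma nth_rising_instance:
  "t < K * Suc n \<Longrightarrow> rising_instance B K \<theta> n ! t =
     Agent (\<theta> (Suc (t div Suc n)) powr (real (t mod Suc n) / real n)) (Suc (t div Suc n)) B"
  by (simp add: rising_instance_def del: mult_Suc_right)

lemma valid_rising_instance:
  assumes "B \<ge> 0" and \<theta>: "\<forall>j\<in>{1..K}. 1 \<le> \<theta> j" and "n > 0"
  shows "valid_instance K \<theta> (rising_instance B K \<theta> n)"
  unfolding valid_instance_def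
proof
  fix a assume "a \<in> set (rising_instance B K \<theta> n)"
  then obtain t where t: "t < K * Suc n" and a: "a = rising_instance B K \<theta> n ! t"
    by (metis in_set_conv_nth length_rising_instance)
  have j: "t div Suc n < K" using t by (simp add: less_mult_imp_div_less)
  then have "1 \<le> \<theta> (Suc (t div Suc n))" using \<theta> by simp
  moreover have "real (t mod Suc n) / real n \<le> 1"
    using \<open>n > 0\<close> by (simp add: less_Suc_eq_le[symmetric])
  ultimately have "\<theta> (Suc (t div Suc n)) powr (real (t mod Suc n) / real n) \<in> {1..\<theta> (Suc (t div Suc n))}"
    using powr_mono[of "real (t mod Suc n) / real n" 1 "\<theta> (Suc (t div Suc n))"]
    by (simp add: ge_one_powr_ge_zero)
  then show "valid_agent K \<theta> a"
    using j \<open>B \<ge> 0\<close> by (simp add: a nth_rising_instance[OF t] valid_agent_def)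
qed

text \<open>The prefix ends at step \<open>i\<close> of block \<open>k\<close>, so its agents of
  class \<open>Suc k\<close> are exactly the first \<open>i + 1\<close> of that block.\<close>

lemma utility_take_rising_instance:
  assumes "k < K" "i \<le> n" and x: "length x = K * Suc n"
  shows "utility (take (Suc (k * Suc n + i)) (rising_instance B K \<theta> n)) (Suc k)
           (take (Suc (k * Suc n + i)) x)
         = (\<Sum>l\<le>i. \<theta> (Suc k) powr (real l / real n) * x ! (k * Suc n + l))"
proof -
  let ?I = "rising_instance B K \<theta> n" and ?T = "Suc (k * Suc n + i)"
  have "Suc k * Suc n \<le> K * Suc n" using \<open>k < K\<close> by (intro mult_le_mono1) simp
  then have T: "?T \<le> K * Suc n" using \<open>i \<le> n\<close> by simp
  have set_eq: "{s. s < length (take ?T ?I) \<and> agent_class (take ?T ?I ! s) = Suc k}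
      = (\<lambda>l. k * Suc n + l) ` {..i}"
  proof (intro set_eqI iffI)
    fix s assume "s \<in> {s. s < length (take ?T ?I) \<and> agent_class (take ?T ?I ! s) = Suc k}"
    then have s: "s < ?T" and "s div Suc n = k"
      using T by (auto simp: nth_rising_instance simp del: mult_Suc_right)
    then have "k * Suc n + s mod Suc n = s" by (metis div_mult_mod_eq)
    with s show "s \<in> (\<lambda>l. k * Suc n + l) ` {..i}"
      by (intro image_eqI[where x = "s mod Suc n"]) auto
  next
    fix s assume "s \<in> (\<lambda>l. k * Suc n + l) ` {..i}"
    then obtain l where l: "l \<le> i" and s: "s = k * Suc n + l" by auto
    have "s div Suc n = k" unfolding s using l \<open>i \<le> n\<close> by (intro div_nat_eqI) auto
    then show "s \<in> {s. s < length (take ?T ?I) \<and> agent_class (take ?T ?I ! s) = Suc k}"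
      using T l s by (simp add: nth_rising_instance del: mult_Suc_right)
  qed
  show ?thesis
    unfolding utility_def set_eq
  proof (subst sum.reindex)
    show "inj_on (\<lambda>l. k * Suc n + l) {..i}" by (simp add: inj_on_def)
    show "sum ((\<lambda>s. valuation (take ?T ?I ! s) * take ?T x ! s) \<circ> (\<lambda>l. k * Suc n + l)) {..i}
      = (\<Sum>l\<le>i. \<theta> (Suc k) powr (real l / real n) * x ! (k * Suc n + l))"
    proof (rule sum.cong)
      fix l assume "l \<in> {..i}"
      then have l: "l \<le> i" "l < Suc n" using \<open>i \<le> n\<close> by auto
      then have "(k * Suc n + l) div Suc n = k" "(k * Suc n + l) mod Suc n = l"
        by (auto intro!: div_nat_eqI simp: less_Suc_eq_le simp del: mult_Suc_right)
      with T l x show "((\<lambda>s. valuation (take ?T ?I ! s) * take ?T x ! s) \<circ> (\<lambda>l. k * Suc n + l)) l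
          = \<theta> (Suc k) powr (real l / real n) * x ! (k * Suc n + l)"
        by (simp add: nth_rising_instance del: mult_Suc_right)
    qed simp
  qed
qed

lemma pf_online_algorithm_discrete_bound:
  assumes B: "B > 0" and K: "K \<ge> 1" and \<theta>: "\<forall>j\<in>{1..K}. 1 \<le> \<theta> j" and "\<beta> > 0" and n: "n > 0"
    and A: "pf_online_algorithm B K \<theta> \<beta> A"
  shows "(\<Sum>j\<in>{1..K}. 1 + real n * (1 - \<theta> j powr (- 1 / real n))) \<le> real K * \<beta>"
proof -
  let ?m = "Suc n"
  define I where "I = rising_instance B K \<theta> n"
  define x where "x = run A I"
  \<comment> \<open>The utility that fairness forces on a class per unit of its latest
    valuation.\<close>
  define c where "c = B / (real K * \<beta>)"
  have c: "c > 0" using B K \<open>\<beta> > 0\<close> by (simp add: c_def)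
  have len: "length I = K * ?m" by (simp add: I_def)
  have valid: "valid_instance K \<theta> I"
    unfolding I_def using B by (intro valid_rising_instance \<theta> n) simp
  have class_bound: "c * (1 + real n * (1 - \<theta> (Suc k) powr (- 1 / real n)))
      \<le> (\<Sum>l\<le>n. x ! (k * ?m + l))" if k: "k < K" for k
  proof -
    define v where "v i = \<theta> (Suc k) powr (real i / real n)" for i
    have \<theta>k: "1 \<le> \<theta> (Suc k)" using \<theta> k by simp
    have pos: "v i > 0" for i using \<theta>k by (simp add: v_def)
    have "mono v"
      using \<theta>k n by (auto simp: mono_def v_def intro!: powr_mono divide_right_mono)
    moreover have "c * v i \<le> (\<Sum>l\<le>i. v l * x ! (k * ?m + l))" if i: "i \<le> n" for i
    proof -
      \<comment> \<open>Stop the instance right after step \<open>i\<close> of class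
        \<open>Suc k\<close>: the last agent then has valuation \<open>v i\<close>, and fairness on
        this prefix bounds the utility of its class.\<close>
      let ?t = "k * ?m + i"
      let ?J = "take (Suc ?t) I"
      have "Suc k * ?m \<le> K * ?m" using k by (intro mult_le_mono1) simp
      then have t: "?t < K * ?m" using i by simp
      have dm: "?t div ?m = k" "?t mod ?m = i"
        using i by (auto intro!: div_nat_eqI simp: less_Suc_eq_le simp del: mult_Suc_right)
      have J: "?J ! ?t = Agent (v i) (Suc k) B"
        using t dm by (simp add: I_def nth_rising_instance v_def del: mult_Suc_right)
      have vJ: "valid_instance K \<theta> ?J" using valid by (rule valid_instance_take)
      then have "proportionally_fair B K \<beta> ?J (run A ?J)"
        using A by (simp add: pf_online_algorithm_def)
      from proportionally_fair_utility_ge[OF this vJ, of ?t]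
      have "v i * B \<le> real K * \<beta> * utility ?J (Suc k) (run A ?J)"
        using t B K len J by (simp del: mult_Suc_right)
      also have "utility ?J (Suc k) (run A ?J) = (\<Sum>l\<le>i. v l * x ! (k * ?m + l))"
        unfolding run_take x_def v_def I_def
        by (rule utility_take_rising_instance[OF k i]) simp
      finally show ?thesis
        using K \<open>\<beta> > 0\<close> by (simp add: c_def field_simps)
    qed
    ultimately have "c * (1 + (\<Sum>i<n. 1 - v i / v (Suc i))) \<le> (\<Sum>l\<le>n. x ! (k * ?m + l))"
      using pos by (intro sum_ge_of_weighted_sums_ge)
    \<comment> \<open>The valuations are geometric, so the \<open>n\<close> summands are all
      equal.\<close>
    moreover have "v i / v (Suc i) = \<theta> (Suc k) powr (- 1 / real n)" for i
      unfolding v_def powr_diff[symmetric] by (simp add: diff_divide_distrib[symmetric])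
    ultimately show ?thesis by simp
  qed
  have "c * (\<Sum>j\<in>{1..K}. 1 + real n * (1 - \<theta> j powr (- 1 / real n)))
      = (\<Sum>k<K. c * (1 + real n * (1 - \<theta> (Suc k) powr (- 1 / real n))))"
    by (simp add: sum_distrib_left sum.atLeast1_atMost_eq)
  also have "\<dots> \<le> (\<Sum>k<K. \<Sum>l\<le>n. x ! (k * ?m + l))"
    by (intro sum_mono class_bound) simp
  \<comment> \<open>The blocks tile the instance, so the amounts spent on the classes add up to the
    total spent.\<close>
  also have "\<dots> = (\<Sum>t<K * ?m. x ! t)"
  proof -
    have "(\<Sum>l\<le>n. x ! (k * ?m + l)) = sum ((!) x) {k * ?m..<k * ?m + ?m}" for k
      using sum.shift_bounds_nat_ivl[of "(!) x" 0 "k * ?m" ?m]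
      by (simp add: atLeast0LessThan lessThan_Suc_atMost add.commute del: sum.lessThan_Suc)
    then show ?thesis by (simp only: sum.nat_group)
  qed
  also have "\<dots> \<le> B"
  proof -
    have "x \<in> feasible B I"
      using A valid by (simp add: pf_online_algorithm_def online_algorithm_def x_def)
    then show ?thesis by (simp add: feasible_def len)
  qed
  \<comment> \<open>In this form the positive factor \<open>c\<close> cancels from both
    sides.\<close>
  also have "B = c * (real K * \<beta>)" using K \<open>\<beta> > 0\<close> by (simp add: c_def)
  finally show ?thesis using c by simp
qed

theorem theorem4:
  fixes B :: real and K :: nat and \<theta> \<alpha> :: "nat \<Rightarrow> real"
  assumes "B > 0"
    and "K \<ge> 1"
    and "\<forall>j\<in>{1..K}. 1 \<le> \<theta> j"
    and "mono_on {1..K} \<theta>"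
    and "\<forall>j\<in>{1..K}. \<alpha> j = 1 + ln (\<theta> j)"
  shows "\<not> (\<exists>\<beta> A. \<beta> \<ge> 1 \<and> \<beta> < (1 / real K) * (\<Sum>j\<in>{1..K}. \<alpha> j) \<and>
                   pf_online_algorithm B K \<theta> \<beta> A)"
proof clarify
  fix \<beta> A
  assume \<beta>: "1 \<le> \<beta>" "\<beta> < (1 / real K) * (\<Sum>j\<in>{1..K}. \<alpha> j)"
    and A: "pf_online_algorithm B K \<theta> \<beta> A"
  have "(\<lambda>n. \<Sum>j\<in>{1..K}. 1 + real n * (1 - \<theta> j powr (- 1 / real n)))
      \<longlonglongrightarrow> (\<Sum>j\<in>{1..K}. 1 + ln (\<theta> j))"
    using assms(3) by (intro tendsto_sum tendsto_add tendsto_const powr_step_tendsto_ln) force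
  moreover have "\<forall>\<^sub>F n in sequentially.
      (\<Sum>j\<in>{1..K}. 1 + real n * (1 - \<theta> j powr (- 1 / real n))) \<le> real K * \<beta>"
    using eventually_gt_at_top[of 0]
  proof eventually_elim
    case (elim n)
    show ?case
      using \<beta>(1) by (intro pf_online_algorithm_discrete_bound[OF assms(1-3) _ elim A]) simp
  qed
  \<comment> \<open>The bound by \<open>K * \<beta>\<close> holds for every positive
    \<open>n\<close> and survives the limit as a weak inequality, which contradicts the strict upper
    bound on \<beta>.\<close>
  ultimately have "(\<Sum>j\<in>{1..K}. 1 + ln (\<theta> j)) \<le> real K * \<beta>"
    by (rule tendsto_upperbound) simp
  with \<beta>(2) assms(2,5) show False
    by (simp add: field_simps)
qed

end
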